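(* For every integer $n>1$, $\mathrm{Conv}(\mathbb{R}^n)$ contains (as sublattices) copies of $M_{n+1}$ consisting of open bounded sets and copies of $M_{n+1}$ consisting of closed unbounded sets (apart from the empty set), in both cases with least element $\emptyset$; and $\mathrm{Conv}(\mathbb{R}^n)_{\geq\{0\}}$ contains copies of $M_{n+1}$ consisting of bounded sets, with least element $\{0\}$. Also, $\mathrm{Conv}(\mathbb{R}^2)_{\geq\{0\}}$ (and hence $\mathrm{Conv}(\mathbb{R}^n)_{\geq\{0\}}$ for all $n>1$) contains copies of $M_c$, the height-$2$ lattice of continuum cardinality (and hence contains copies of its sublattices $M_m$ for all natural numbers $m$), consisting of vector subspaces, with least element $\{0\}$. In particular, for $n>1$ neither $\mathrm{Conv}(\mathbb{R}^n)$ nor $\mathrm{Conv}(\mathbb{R}^n)_{\geq\{0\}}$ is $N$-join semidistributive or $N$-meet semidistributive for any positive integer $N$, and the sublattice of open bounded sets in $\mathrm{Conv}(\mathbb{R}^n)$ and the sublattice of bounded sets in $\mathrm{Conv}(\mathbb{R}^n)_{\geq\{0\}}$ are neither $(n-1)$-join semidistributive nor $(n-1)$-meet semidistributive.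
   Context: $\mathrm{Conv}(\mathbb{R}^n)$ is the lattice of all convex subsets of $\mathbb{R}^n$ (including $\emptyset$), with $x\wedge y=x\cap y$ and $x\vee y=$ the convex hull of $x\cup y$. $\mathrm{Conv}(\mathbb{R}^n)_{\geq\{0\}}$ is its sublattice of convex sets containing the origin. For a cardinal $m$, $M_m$ is the lattice of height $2$ consisting of a least element, a greatest element, and $m$ pairwise incomparable elements strictly between them (the join of any two distinct ones being the greatest element, and the meet the least element); $c$ denotes the cardinality of the continuum. For a positive integer $N$, a lattice $L$ is $N$-join semidistributive if for all $x,y_1,\dots,y_{N+1}\in L$, $$x\vee y_1=\dots=x\vee y_{N+1}\ \implies\ x\vee y_1=x\vee\Big(\bigvee_{i\neq j}(y_i\wedge y_j)\Big),$$ the join being over distinct $i,j\in\{1,\dots,N+1\}$. $N$-meet semidistributivity is the dual condition (interchange $\wedge$ and $\vee$). *)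

theory Defs
  imports "HOL-Algebra.Lattice" "HOL-Analysis.Analysis"
begin

text \<open>Lattices are the explicit-carrier ones of \<^theory>\<open>HOL-Algebra.Lattice\<close>; joins and meets
  are derived there from the order.\<close>

subsection \<open>Sublattices and copies of lattices\<close>

definition sublattice :: "'a set \<Rightarrow> 'a gorder \<Rightarrow> bool" where
  "sublattice S L \<longleftrightarrow> S \<subseteq> carrier L \<and>
     (\<forall>x\<in>S. \<forall>y\<in>S. x \<squnion>\<^bsub>L\<^esub> y \<in> S \<and> x \<sqinter>\<^bsub>L\<^esub> y \<in> S)"

definition lattice_copy :: "'b gorder \<Rightarrow> 'a gorder \<Rightarrow> 'a set \<Rightarrow> bool" where
  "lattice_copy K L S \<longleftrightarrow> sublattice S L \<and>
     (\<exists>f. bij_betw f (carrier K) S \<and>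
          (\<forall>x\<in>carrier K. \<forall>y\<in>carrier K.
             f (x \<squnion>\<^bsub>K\<^esub> y) = f x \<squnion>\<^bsub>L\<^esub> f y \<and> f (x \<sqinter>\<^bsub>K\<^esub> y) = f x \<sqinter>\<^bsub>L\<^esub> f y))"

text \<open>A sublattice \<open>S\<close> of \<open>L\<close>, as a lattice in its own right, is written \<open>L\<lparr>carrier := S\<rparr>\<close>. The
  operations the library derives for it from the restricted order are those inherited from \<open>L\<close>:\<close>

lemma join_eqI:
  assumes "partial_order L" "least L s (Upper L {x, y})"
  shows "x \<squnion>\<^bsub>L\<^esub> y = s"
proof -
  interpret partial_order L by fact
  show ?thesis
    unfolding join_def sup_def
    by (rule some_equality) (use assms least_unique in blast)+
qed

lemma meet_eqI:
  assumes "partial_order L" "greatest L s (Lower L {x, y})"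
  shows "x \<sqinter>\<^bsub>L\<^esub> y = s"
proof -
  interpret partial_order L by fact
  show ?thesis
    unfolding meet_def inf_def
    by (rule some_equality) (use assms greatest_unique in blast)+
qed

lemma sublattice_inherits:
  fixes L :: "'a gorder"
  assumes "Lattice.lattice L" "sublattice S L"
  shows "Lattice.lattice (L\<lparr>carrier := S\<rparr>)"
    and "\<And>x y. x \<in> S \<Longrightarrow> y \<in> S \<Longrightarrow> x \<squnion>\<^bsub>L\<lparr>carrier := S\<rparr>\<^esub> y = x \<squnion>\<^bsub>L\<^esub> y"
    and "\<And>x y. x \<in> S \<Longrightarrow> y \<in> S \<Longrightarrow> x \<sqinter>\<^bsub>L\<lparr>carrier := S\<rparr>\<^esub> y = x \<sqinter>\<^bsub>L\<^esub> y"
proof -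
  interpret L: Lattice.lattice L by fact
  let ?R = "L\<lparr>carrier := S\<rparr>"
  have S: "S \<subseteq> carrier L" and c: "\<And>x y. x \<in> S \<Longrightarrow> y \<in> S \<Longrightarrow> x \<squnion>\<^bsub>L\<^esub> y \<in> S"
      "\<And>x y. x \<in> S \<Longrightarrow> y \<in> S \<Longrightarrow> x \<sqinter>\<^bsub>L\<^esub> y \<in> S"
    using assms(2) by (auto simp: sublattice_def)
  note SD = subsetD[OF S]
  have po: "partial_order ?R"
    by unfold_locales
      (auto simp: L.eq_is_equal dest!: SD intro: L.le_antisym L.le_trans)
  have lub: "least ?R (x \<squnion>\<^bsub>L\<^esub> y) (Upper ?R {x, y})" if "x \<in> S" "y \<in> S" for x y
    using that S c
    by (auto simp: least_def Upper_def intro!: L.join_left L.join_right L.join_le)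
  have glb: "greatest ?R (x \<sqinter>\<^bsub>L\<^esub> y) (Lower ?R {x, y})" if "x \<in> S" "y \<in> S" for x y
    using that S c
    by (auto simp: greatest_def Lower_def intro!: L.meet_left L.meet_right L.meet_le)
  interpret R: partial_order ?R by (rule po)
  show "Lattice.lattice ?R"
    by unfold_locales (simp, blast intro: lub glb)+
  show "x \<squnion>\<^bsub>?R\<^esub> y = x \<squnion>\<^bsub>L\<^esub> y" if "x \<in> S" "y \<in> S" for x y
    using join_eqI[OF po lub] that by blast
  show "x \<sqinter>\<^bsub>?R\<^esub> y = x \<sqinter>\<^bsub>L\<^esub> y" if "x \<in> S" "y \<in> S" for x y
    using meet_eqI[OF po glb] that by blast
qed

subsection \<open>The lattices of height two\<close>

datatype 'i height2 = Bot | Atom 'i | Top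

text \<open>\<open>M_lat I\<close> is the lattice \<open>M\<^sub>m\<close> with \<open>m\<close> the cardinality of the index set \<open>I\<close>.\<close>

definition M_lat :: "'i set \<Rightarrow> 'i height2 gorder" where
  "M_lat I = \<lparr>carrier = {Bot, Top} \<union> Atom ` I, eq = (=), le = (\<lambda>x y. x = Bot \<or> x = y \<or> y = Top)\<rparr>"

lemma partial_order_M_lat: "partial_order (M_lat I)"
  by unfold_locales (auto simp: M_lat_def)

lemma M_lat_join: "i \<in> I \<Longrightarrow> j \<in> I \<Longrightarrow> i \<noteq> j \<Longrightarrow> Atom i \<squnion>\<^bsub>M_lat I\<^esub> Atom j = Top"
  by (rule join_eqI[OF partial_order_M_lat]) (auto simp: M_lat_def least_def Upper_def)

lemma M_lat_meet: "i \<in> I \<Longrightarrow> j \<in> I \<Longrightarrow> i \<noteq> j \<Longrightarrow> Atom i \<sqinter>\<^bsub>M_lat I\<^esub> Atom j = Bot"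
  by (rule meet_eqI[OF partial_order_M_lat]) (auto simp: M_lat_def greatest_def Lower_def)

lemma lattice_M_lat: "Lattice.lattice (M_lat I)"
proof -
  interpret partial_order "M_lat I" by (rule partial_order_M_lat)
  show ?thesis
  proof unfold_locales
    fix x y assume "x \<in> carrier (M_lat I)" "y \<in> carrier (M_lat I)"
    then show "\<exists>s. least (M_lat I) s (Upper (M_lat I) {x, y})"
      by (intro exI[of _ "if x = Bot then y else if y = Bot \<or> x = y then x else Top"])
        (cases x; cases y; auto simp: M_lat_def least_def Upper_def)
  next
    fix x y assume "x \<in> carrier (M_lat I)" "y \<in> carrier (M_lat I)"
    then show "\<exists>s. greatest (M_lat I) s (Lower (M_lat I) {x, y})"
      by (intro exI[of _ "if x = Top then y else if y = Top \<or> x = y then x else Bot"])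
        (cases x; cases y; auto simp: M_lat_def greatest_def Lower_def)
  qed
qed

subsection \<open>Semidistributivity\<close>

definition join_semidistributive :: "nat \<Rightarrow> 'a gorder \<Rightarrow> bool" where
  "join_semidistributive N L \<longleftrightarrow>
     (\<forall>x\<in>carrier L. \<forall>y\<in>{1..N+1} \<rightarrow> carrier L.
        (\<forall>i\<in>{1..N+1}. x \<squnion>\<^bsub>L\<^esub> y i = x \<squnion>\<^bsub>L\<^esub> y 1) \<longrightarrow>
        x \<squnion>\<^bsub>L\<^esub> y 1 =
          x \<squnion>\<^bsub>L\<^esub> \<Squnion>\<^bsub>L\<^esub> {y i \<sqinter>\<^bsub>L\<^esub> y j | i j. i \<in> {1..N+1} \<and> j \<in> {1..N+1} \<and> i \<noteq> j})"

definition meet_semidistributive :: "nat \<Rightarrow> 'a gorder \<Rightarrow> bool" where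
  "meet_semidistributive N L \<longleftrightarrow>
     (\<forall>x\<in>carrier L. \<forall>y\<in>{1..N+1} \<rightarrow> carrier L.
        (\<forall>i\<in>{1..N+1}. x \<sqinter>\<^bsub>L\<^esub> y i = x \<sqinter>\<^bsub>L\<^esub> y 1) \<longrightarrow>
        x \<sqinter>\<^bsub>L\<^esub> y 1 =
          x \<sqinter>\<^bsub>L\<^esub> \<Sqinter>\<^bsub>L\<^esub> {y i \<squnion>\<^bsub>L\<^esub> y j | i j. i \<in> {1..N+1} \<and> j \<in> {1..N+1} \<and> i \<noteq> j})"

subsection \<open>Lattices of convex sets\<close>

definition Conv :: "'a::real_vector set gorder" where
  "Conv = \<lparr>carrier = {A. convex A}, eq = (=), le = (\<subseteq>)\<rparr>"

definition Conv0 :: "'a::real_vector set gorder" where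
  "Conv0 = Conv\<lparr>carrier := {A. convex A \<and> 0 \<in> A}\<rparr>"

lemma carrier_Conv [simp]: "carrier Conv = {A. convex A}"
  by (simp add: Conv_def)

lemma carrier_Conv0 [simp]: "carrier Conv0 = {A. convex A \<and> 0 \<in> A}"
  by (simp add: Conv0_def)

lemma partial_order_Conv: "partial_order Conv"
  by unfold_locales (auto simp: Conv_def)

lemma Conv_least_Upper:
  "convex A \<Longrightarrow> convex B \<Longrightarrow> least Conv (convex hull (A \<union> B)) (Upper Conv {A, B})"
  by (auto simp: Conv_def least_def Upper_def hull_inc subset_hull)

lemma Conv_greatest_Lower:
  "convex A \<Longrightarrow> convex B \<Longrightarrow> greatest Conv (A \<inter> B) (Lower Conv {A, B})"
  by (auto simp: Conv_def greatest_def Lower_def convex_Int)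

lemma Conv_join: "convex A \<Longrightarrow> convex B \<Longrightarrow> A \<squnion>\<^bsub>Conv\<^esub> B = convex hull (A \<union> B)"
  by (intro join_eqI partial_order_Conv Conv_least_Upper)

lemma Conv_meet: "convex A \<Longrightarrow> convex B \<Longrightarrow> A \<sqinter>\<^bsub>Conv\<^esub> B = A \<inter> B"
  by (intro meet_eqI partial_order_Conv Conv_greatest_Lower)

lemma lattice_Conv: "Lattice.lattice Conv"
proof -
  interpret partial_order Conv by (rule partial_order_Conv)
  show ?thesis
    by unfold_locales (simp, blast intro: Conv_least_Upper Conv_greatest_Lower)+
qed

lemma sublattice_Conv0: "sublattice (carrier Conv0) Conv"
  by (auto simp: sublattice_def Conv_join Conv_meet convex_Int hull_inc)

lemma lattice_Conv0: "Lattice.lattice Conv0"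
  unfolding Conv0_def
  using sublattice_inherits(1)[OF lattice_Conv sublattice_Conv0] by simp

lemma Conv0_join:
  fixes A B :: "'a::real_vector set"
  assumes "A \<in> carrier Conv0" "B \<in> carrier Conv0"
  shows "A \<squnion>\<^bsub>Conv0\<^esub> B = convex hull (A \<union> B)"
  using sublattice_inherits(2)[OF lattice_Conv sublattice_Conv0 assms] assms
  by (simp add: Conv0_def Conv_join)

lemma Conv0_meet:
  fixes A B :: "'a::real_vector set"
  assumes "A \<in> carrier Conv0" "B \<in> carrier Conv0"
  shows "A \<sqinter>\<^bsub>Conv0\<^esub> B = A \<inter> B"
  using sublattice_inherits(3)[OF lattice_Conv sublattice_Conv0 assms] assms
  by (simp add: Conv0_def Conv_meet)

lemma sublattice_open_bounded:
  "sublattice {A. convex A \<and> open A \<and> bounded A} (Conv :: 'a::euclidean_space set gorder)"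
  by (auto simp: sublattice_def Conv_join Conv_meet convex_Int bounded_convex_hull open_convex_hull)

lemma sublattice_bounded0:
  "sublattice {A. convex A \<and> 0 \<in> A \<and> bounded A} (Conv0 :: 'a::euclidean_space set gorder)"
  by (auto simp: sublattice_def Conv0_join Conv0_meet convex_Int bounded_convex_hull hull_inc)

end

theory Submission
  imports Defs "HOL-Algebra.Complete_Lattice"
begin

text \<open>Let \<open>n + 1\<close> vectors \<open>v\<^sub>k\<close> in \<open>\<real>\<^sup>n\<close> sum to \<open>0\<close>, any \<open>n\<close> of them independent, and divide the space into
  sectors according to the \<open>k\<close> for which \<open>v\<^sub>k \<bullet> x\<close> is smallest. For \<open>i \<noteq> j\<close> there is a direction \<open>d\<close>
  with \<open>v\<^sub>j \<bullet> d = 1\<close>, \<open>v\<^sub>i \<bullet> d = - 1\<close> and \<open>v\<^sub>k \<bullet> d = 0\<close> for the other \<open>k\<close>. Moving away from any point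
  along \<open>d\<close> leads into the \<open>i\<close>-th sector, and moving along \<open>- d\<close> into the \<open>j\<close>-th, so the hull of two
  sectors is everything. Intersecting with the simplex \<open>v\<^sub>k \<bullet> x > - 1\<close> gives the open bounded copy,
  adjoining the origin the bounded copy over \<open>{0}\<close>, and replacing \<open>v\<^sub>i \<bullet> x < v\<^sub>k \<bullet> x\<close> by
  \<open>v\<^sub>i \<bullet> x + 1 \<le> v\<^sub>k \<bullet> x\<close> the closed unbounded copy. Lines through \<open>0\<close> in a plane give \<open>M\<^sub>c\<close>.
  In \<open>M\<^sub>N\<^sub>+\<^sub>2\<close>, one atom against the other \<open>N + 1\<close> violates both \<open>N\<close>-semidistributive laws.\<close>

section \<open>Copies of height-two lattices and the semidistributive laws\<close>

lemma join_absorb: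
  assumes "Lattice.lattice L" "x \<in> carrier L" "y \<in> carrier L" "x \<sqsubseteq>\<^bsub>L\<^esub> y"
  shows "x \<squnion>\<^bsub>L\<^esub> y = y" "y \<squnion>\<^bsub>L\<^esub> x = y"
proof -
  interpret Lattice.lattice L by fact
  show "x \<squnion>\<^bsub>L\<^esub> y = y" "y \<squnion>\<^bsub>L\<^esub> x = y"
    by (intro join_eqI partial_order_axioms; use assms in \<open>auto simp: least_def Upper_def\<close>)+
qed

lemma meet_absorb:
  assumes "Lattice.lattice L" "x \<in> carrier L" "y \<in> carrier L" "x \<sqsubseteq>\<^bsub>L\<^esub> y"
  shows "x \<sqinter>\<^bsub>L\<^esub> y = x" "y \<sqinter>\<^bsub>L\<^esub> x = x"
proof -
  interpret Lattice.lattice L by fact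
  show "x \<sqinter>\<^bsub>L\<^esub> y = x" "y \<sqinter>\<^bsub>L\<^esub> x = x"
    by (intro meet_eqI partial_order_axioms; use assms in \<open>auto simp: greatest_def Lower_def\<close>)+
qed

text \<open>Comparable pairs of \<open>M_lat I\<close> are settled by absorption on both sides,
  which leaves only two distinct atoms, where \<open>meet\<close> and \<open>join\<close> apply. The
  order relations and \<open>B \<noteq> T\<close> are assumed separately so that \<open>I\<close>
  may have fewer than two elements.\<close>

lemma lattice_copy_M_lat:
  fixes L :: "'a gorder"
  assumes L: "Lattice.lattice L"
    and B: "B \<in> carrier L" and T: "T \<in> carrier L" and F: "\<And>i. i \<in> I \<Longrightarrow> F i \<in> carrier L"
    and le: "B \<sqsubseteq>\<^bsub>L\<^esub> T" "\<And>i. i \<in> I \<Longrightarrow> B \<sqsubseteq>\<^bsub>L\<^esub> F i" "\<And>i. i \<in> I \<Longrightarrow> F i \<sqsubseteq>\<^bsub>L\<^esub> T"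
    and ne: "B \<noteq> T" "\<And>i. i \<in> I \<Longrightarrow> F i \<noteq> B" "\<And>i. i \<in> I \<Longrightarrow> F i \<noteq> T"
    and meet: "\<And>i j. i \<in> I \<Longrightarrow> j \<in> I \<Longrightarrow> i \<noteq> j \<Longrightarrow> F i \<sqinter>\<^bsub>L\<^esub> F j = B"
    and join: "\<And>i j. i \<in> I \<Longrightarrow> j \<in> I \<Longrightarrow> i \<noteq> j \<Longrightarrow> F i \<squnion>\<^bsub>L\<^esub> F j = T"
  shows "lattice_copy (M_lat I) L ({B, T} \<union> F ` I)"
proof -
  interpret Lattice.lattice L by fact
  define f where "f = case_height2 B F T"
  have f [simp]: "f Bot = B" "f Top = T" "f (Atom i) = F i" for i
    by (simp_all add: f_def)
  \<comment> \<open>If \<open>i \<noteq> j\<close> but \<open>F i = F j\<close>, then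
    \<open>F i\<close> is its own meet with \<open>F j\<close>, hence equal to
    \<open>B\<close>.\<close>
  have inj: "i = j" if "i \<in> I" "j \<in> I" "F i = F j" for i j
    using meet[of i j] meet_absorb(1)[OF L F F, of i i] F[of i] ne(2)[of i] that by force
  have img: "f ` carrier (M_lat I) = {B, T} \<union> F ` I"
    by (force simp: M_lat_def image_iff)
  have fc: "f x \<in> carrier L" if "x \<in> carrier (M_lat I)" for x
    using that B T F by (auto simp: M_lat_def)
  have mono: "f x \<sqsubseteq>\<^bsub>L\<^esub> f y"
    if "x \<in> carrier (M_lat I)" "y \<in> carrier (M_lat I)" "x \<sqsubseteq>\<^bsub>M_lat I\<^esub> y" for x y
    using that B T F le by (auto simp: M_lat_def)
  have hom: "f (x \<squnion>\<^bsub>M_lat I\<^esub> y) = f x \<squnion>\<^bsub>L\<^esub> f y \<and> f (x \<sqinter>\<^bsub>M_lat I\<^esub> y) = f x \<sqinter>\<^bsub>L\<^esub> f y"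
    if xy: "x \<in> carrier (M_lat I)" "y \<in> carrier (M_lat I)" for x y
  proof -
    consider "x \<sqsubseteq>\<^bsub>M_lat I\<^esub> y" | "y \<sqsubseteq>\<^bsub>M_lat I\<^esub> x"
      | i j where "x = Atom i" "y = Atom j" "i \<in> I" "j \<in> I" "i \<noteq> j"
      using xy by (auto simp: M_lat_def)
    then show ?thesis
    proof cases
      case 1
      then show ?thesis
        using xy mono[OF xy] by (simp add: join_absorb[OF lattice_M_lat] meet_absorb[OF lattice_M_lat]
            join_absorb[OF L] meet_absorb[OF L] fc)
    next
      case 2
      then show ?thesis
        using xy mono[OF xy(2,1)] by (simp add: join_absorb[OF lattice_M_lat]
            meet_absorb[OF lattice_M_lat] join_absorb[OF L] meet_absorb[OF L] fc)
    next
      case 3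
      then show ?thesis
        by (simp add: M_lat_join M_lat_meet join meet)
    qed
  qed
  have "inj_on f (carrier (M_lat I))"
    using ne inj by (auto simp: inj_on_def M_lat_def)
  then have bij: "bij_betw f (carrier (M_lat I)) ({B, T} \<union> F ` I)"
    using img by (simp add: bij_betw_def)
  interpret M: Lattice.lattice "M_lat I" by (rule lattice_M_lat)
  have "sublattice (f ` carrier (M_lat I)) L"
    unfolding sublattice_def
    by (simp add: fc image_subset_iff flip: hom)
  then show ?thesis
    unfolding lattice_copy_def using bij hom img by auto
qed

text \<open>Operations on elements of \<open>S'\<close> are inherited from \<open>L\<close>, so a
  copy inside \<open>S'\<close> can be moved between the two lattices. This serves
  \<open>Conv0\<close> inside \<open>Conv\<close> and the sublattices of bounded sets.\<close>

lemma lattice_copy_sublattice_iff: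
  assumes "Lattice.lattice L" "sublattice S' L" "S \<subseteq> S'"
  shows "lattice_copy K (L\<lparr>carrier := S'\<rparr>) S \<longleftrightarrow> lattice_copy K L S"
proof -
  note inh = sublattice_inherits(2,3)[OF assms(1,2)]
  have "S' \<subseteq> carrier L"
    using assms(2) by (simp add: sublattice_def)
  then have "sublattice S (L\<lparr>carrier := S'\<rparr>) \<longleftrightarrow> sublattice S L"
    using assms(3) by (simp add: sublattice_def inh subset_iff)
  moreover have "f x \<squnion>\<^bsub>L\<lparr>carrier := S'\<rparr>\<^esub> f y = f x \<squnion>\<^bsub>L\<^esub> f y \<and> f x \<sqinter>\<^bsub>L\<lparr>carrier := S'\<rparr>\<^esub> f y = f x \<sqinter>\<^bsub>L\<^esub> f y"
    if "bij_betw f (carrier K) S" "x \<in> carrier K" "y \<in> carrier K" for f x y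
    using that assms(3) by (intro conjI inh) (auto dest: bij_betwE)
  ultimately show ?thesis
    unfolding lattice_copy_def by (intro conj_cong ex_cong1 ball_cong refl) auto
qed

text \<open>Take atom 0 as \<open>x\<close> and the atoms 1 to N + 1 as the \<open>y i\<close>. All
  joins with \<open>x\<close> are the top, while all meets \<open>y i \<sqinter> y j\<close> are the
  bottom, so the right-hand side of the join law collapses to atom 0. The meet law fails
  dually.\<close>

lemma not_semidistributive_if_lattice_copy:
  fixes L :: "'a gorder"
  assumes L: "Lattice.lattice L" and copy: "lattice_copy (M_lat {..<N + 2}) L S" and "N \<ge> 1"
  shows "\<not> join_semidistributive N L" "\<not> meet_semidistributive N L"
proof -
  interpret Lattice.lattice L by fact
  note add_2_eq_Suc' [simp del]
  let ?M = "M_lat {..<N + 2}"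
  obtain f where sub: "sublattice S L" and bij: "bij_betw f (carrier ?M) S"
    and hom: "\<And>x y. x \<in> carrier ?M \<Longrightarrow> y \<in> carrier ?M \<Longrightarrow>
      f (x \<squnion>\<^bsub>?M\<^esub> y) = f x \<squnion>\<^bsub>L\<^esub> f y \<and> f (x \<sqinter>\<^bsub>?M\<^esub> y) = f x \<sqinter>\<^bsub>L\<^esub> f y"
    using copy unfolding lattice_copy_def by blast
  define a where "a i = f (Atom i)" for i
  have cM: "carrier ?M = {Bot, Top} \<union> Atom ` {..<N + 2}"
    by (simp add: M_lat_def)
  have fc: "f x \<in> carrier L" if "x \<in> carrier ?M" for x
    using that sub bij by (auto simp: sublattice_def dest: bij_betwE)
  have a: "a i \<in> carrier L" if "i < N + 2" for i
    using that fc by (simp add: a_def cM)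
  have BT: "f Bot \<in> carrier L" "f Top \<in> carrier L"
    using fc by (simp_all add: cM)
  have join: "a i \<squnion>\<^bsub>L\<^esub> a j = f Top" and meet: "a i \<sqinter>\<^bsub>L\<^esub> a j = f Bot"
    if "i < N + 2" "j < N + 2" "i \<noteq> j" for i j
    using that hom[of "Atom i" "Atom j"] by (simp_all add: a_def cM M_lat_join M_lat_meet)
  have ne: "a 0 \<noteq> f Top" "a 0 \<noteq> f Bot"
    using bij by (auto simp: a_def bij_betw_def inj_on_def cM)
  have le: "f Bot \<sqsubseteq>\<^bsub>L\<^esub> a 0" "a 0 \<sqsubseteq>\<^bsub>L\<^esub> f Top"
    using meet_left[of "a 0" "a 1"] join_left[of "a 0" "a 1"] a[of 0] a[of 1] by (simp_all add: meet join)
  have "{a i \<sqinter>\<^bsub>L\<^esub> a j | i j. i \<in> {1..N+1} \<and> j \<in> {1..N+1} \<and> i \<noteq> j} = {f Bot}"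
  \<comment> \<open>Since \<open>N \<ge> 1\<close>, the distinct indices 1 and 2 are available, so
    the set of pairwise meets is nonempty.\<close>
  proof (intro equalityI)
    show "{f Bot} \<subseteq> {a i \<sqinter>\<^bsub>L\<^esub> a j | i j. i \<in> {1..N+1} \<and> j \<in> {1..N+1} \<and> i \<noteq> j}"
      using meet[of 1 2] \<open>N \<ge> 1\<close>
      by (intro insert_subsetI empty_subsetI CollectI exI[of _ 1] exI[of _ 2]) simp
  qed (auto simp: meet)
  then have "a 0 \<squnion>\<^bsub>L\<^esub> \<Squnion>\<^bsub>L\<^esub> {a i \<sqinter>\<^bsub>L\<^esub> a j | i j. i \<in> {1..N+1} \<and> j \<in> {1..N+1} \<and> i \<noteq> j} = a 0"
    using join_absorb(2)[OF L BT(1) a le(1)] sup_of_singleton[OF BT(1)] by simp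
  moreover have "\<forall>i\<in>{1..N+1}. a 0 \<squnion>\<^bsub>L\<^esub> a i = f Top"
    by (simp add: join)
  moreover have "a 0 \<in> carrier L" "a \<in> {1..N+1} \<rightarrow> carrier L"
    using a by auto
  ultimately show "\<not> join_semidistributive N L"
    unfolding join_semidistributive_def using ne(1) 
    by (intro notI, elim ballE[of _ _ "a 0"] ballE[of _ _ a]) auto
  have "{a i \<squnion>\<^bsub>L\<^esub> a j | i j. i \<in> {1..N+1} \<and> j \<in> {1..N+1} \<and> i \<noteq> j} = {f Top}"
  proof (intro equalityI)
    show "{f Top} \<subseteq> {a i \<squnion>\<^bsub>L\<^esub> a j | i j. i \<in> {1..N+1} \<and> j \<in> {1..N+1} \<and> i \<noteq> j}"
      using join[of 1 2] \<open>N \<ge> 1\<close>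
      by (intro insert_subsetI empty_subsetI CollectI exI[of _ 1] exI[of _ 2]) simp
  qed (auto simp: join)
  then have "a 0 \<sqinter>\<^bsub>L\<^esub> \<Sqinter>\<^bsub>L\<^esub> {a i \<squnion>\<^bsub>L\<^esub> a j | i j. i \<in> {1..N+1} \<and> j \<in> {1..N+1} \<and> i \<noteq> j} = a 0"
    using meet_absorb(1)[OF L a BT(2) le(2)] inf_of_singleton[OF BT(2)] by simp
  moreover have "\<forall>i\<in>{1..N+1}. a 0 \<sqinter>\<^bsub>L\<^esub> a i = f Bot"
    by (simp add: meet)
  moreover have "a 0 \<in> carrier L" "a \<in> {1..N+1} \<rightarrow> carrier L"
    using a by auto
  ultimately show "\<not> meet_semidistributive N L"
    unfolding meet_semidistributive_def using ne(2)
    by (intro notI, elim ballE[of _ _ "a 0"] ballE[of _ _ a]) auto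
qed

text \<open>The assumption on \<open>I\<close> says that it has at least two elements. Then each
  \<open>F k\<close> occurs in some meet \<open>B\<close> and some join \<open>T\<close>, which
  forces the order relations and the remaining distinctness conditions.\<close>

lemma lattice_copy_M_lat_pairwise:
  fixes L :: "'a gorder"
  assumes L: "Lattice.lattice L" and I: "\<And>i. \<exists>j\<in>I. j \<noteq> i"
    and F: "\<And>i. i \<in> I \<Longrightarrow> F i \<in> carrier L" and ne: "\<And>i. i \<in> I \<Longrightarrow> F i \<noteq> T"
    and meet: "\<And>i j. i \<in> I \<Longrightarrow> j \<in> I \<Longrightarrow> i \<noteq> j \<Longrightarrow> F i \<sqinter>\<^bsub>L\<^esub> F j = B"
    and join: "\<And>i j. i \<in> I \<Longrightarrow> j \<in> I \<Longrightarrow> i \<noteq> j \<Longrightarrow> F i \<squnion>\<^bsub>L\<^esub> F j = T"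
  shows "lattice_copy (M_lat I) L ({B, T} \<union> F ` I)"
proof -
  interpret Lattice.lattice L by fact
  obtain i j where ij: "i \<in> I" "j \<in> I" "i \<noteq> j"
    using I by metis
  have BT: "B \<in> carrier L" "T \<in> carrier L"
    using ij F meet[OF ij] join[OF ij] meet_closed[of "F i" "F j"] join_closed[of "F i" "F j"] by auto
  have le: "B \<sqsubseteq>\<^bsub>L\<^esub> F k" "F k \<sqsubseteq>\<^bsub>L\<^esub> T" if "k \<in> I" for k
    using that I[of k] F meet[of k] join[of k] meet_left[of "F k"] join_left[of "F k"] by metis+
  \<comment> \<open>If \<open>F k = B\<close>, then \<open>T = F k \<squnion> F j = F j\<close> for
    some other \<open>j\<close>, contradicting \<open>ne\<close>.\<close>
  have neB: "F k \<noteq> B" if "k \<in> I" for k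
    using that I[of k] join[of k] join_absorb(1)[OF L BT(1) F le(1)] ne by metis
  have "B \<noteq> T"
    using le[OF ij(1)] ne[OF ij(1)] le_antisym F[OF ij(1)] BT by metis
  moreover have "B \<sqsubseteq>\<^bsub>L\<^esub> T"
    using le[OF ij(1)] BT F[OF ij(1)] le_trans by metis
  ultimately show ?thesis
    using BT le neB F ne meet join by (intro lattice_copy_M_lat[OF L]) auto
qed

section \<open>Lines through the origin in a plane\<close>

lemma le_Conv [simp]: "A \<sqsubseteq>\<^bsub>Conv\<^esub> B \<longleftrightarrow> A \<subseteq> B"
  by (simp add: Conv_def)

lemma le_Conv0 [simp]: "A \<sqsubseteq>\<^bsub>Conv0\<^esub> B \<longleftrightarrow> A \<subseteq> B"
  by (simp add: Conv0_def)

lemma convex_hull_Un_subspaces: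
  fixes U V :: "'a::real_vector set"
  assumes "subspace U" "subspace V"
  shows "convex hull (U \<union> V) = {u + v | u v. u \<in> U \<and> v \<in> V}" (is "?H = ?S")
proof
  show "?H \<subseteq> ?S"
  proof (rule hull_minimal)
    show "U \<union> V \<subseteq> ?S"
      using subspace_0[OF assms(1)] subspace_0[OF assms(2)] by force
    show "convex ?S"
      using subspace_imp_convex[OF subspace_sums[OF assms]] .
  qed
  show "?S \<subseteq> ?H"
  proof clarify
    \<comment> \<open>The sum \<open>u + v\<close> is the midpoint of \<open>2 *\<^sub>R u\<close>
      and \<open>2 *\<^sub>R v\<close>, which stay in the subspaces.\<close>
    fix u v assume "u \<in> U" "v \<in> V"
    then have "2 *\<^sub>R u \<in> ?H" "2 *\<^sub>R v \<in> ?H"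
      using assms by (auto intro!: hull_inc subspace_scale)
    then have "(1/2) *\<^sub>R (2 *\<^sub>R u) + (1/2) *\<^sub>R (2 *\<^sub>R v) \<in> ?H"
      by (intro convexD[OF convex_convex_hull]) auto
    then show "u + v \<in> ?H"
      by simp
  qed
qed

text \<open>By \<open>ind\<close> the vectors \<open>a\<close> and \<open>b\<close> are independent,
  so directions \<open>a + r *\<^sub>R b\<close> with distinct slopes are independent too: two such
  lines meet only in 0 and together span the plane. The slope map \<open>g\<close> admits any index
  set that injects into the reals.\<close>

lemma lattice_copy_lines:
  fixes a b :: "'a::real_vector"
  assumes ind: "\<And>s t. s *\<^sub>R a + t *\<^sub>R b = 0 \<Longrightarrow> s = 0 \<and> t = 0" and g: "inj_on g I"
  shows "lattice_copy (M_lat I) Conv0 ({{0}, span {a, b}} \<union> (\<lambda>i. span {a + g i *\<^sub>R b}) ` I)"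
proof -
  have line: "span {x} = range (\<lambda>k. k *\<^sub>R x)" for x :: 'a
    by (rule span_singleton)
  have plane: "span {a, b} = {s *\<^sub>R a + t *\<^sub>R b | s t. True}"
    by (subst insert_is_Un, subst span_Un) (auto simp: line)
  have eqD: "s = s' \<and> t = t'" if "s *\<^sub>R a + t *\<^sub>R b = s' *\<^sub>R a + t' *\<^sub>R b" for s t s' t'
    using ind[of "s - s'" "t - t'"] that by (simp add: algebra_simps)
  have 0: "a + r *\<^sub>R b \<noteq> 0" for r
    using ind[of 1 r] by auto
  \<comment> \<open>The vector \<open>b\<close> lies in the plane but on none of the lines, so each
    line is a proper subset of the plane.\<close>
  have "b \<noteq> k *\<^sub>R (a + r *\<^sub>R b)" for k r
  proof
    assume "b = k *\<^sub>R (a + r *\<^sub>R b)"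
    then have "0 *\<^sub>R a + 1 *\<^sub>R b = k *\<^sub>R a + (k * r) *\<^sub>R b"
      by (metis add_0 scaleR_one scaleR_right_distrib scaleR_scaleR scaleR_zero_left)
    then have "0 = k \<and> 1 = k * r"
      by (rule eqD)
    then show False
      by auto
  qed
  then have b: "b \<notin> span {a + r *\<^sub>R b}" for r
    by (auto simp: line)
  have meet: "span {a + r *\<^sub>R b} \<inter> span {a + s *\<^sub>R b} = {0}" if "r \<noteq> s" for r s
  proof -
    have "k = 0" if "k *\<^sub>R (a + r *\<^sub>R b) = l *\<^sub>R (a + s *\<^sub>R b)" for k l
      using eqD[of k "k * r" l "l * s"] that \<open>r \<noteq> s\<close> by (auto simp: algebra_simps)
    then have "span {a + r *\<^sub>R b} \<inter> span {a + s *\<^sub>R b} \<subseteq> {0}"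
      by (force simp: line)
    then show ?thesis
      by (auto simp: span_zero)
  qed
  have sub: "span {a + r *\<^sub>R b} \<subseteq> span {a, b}" for r
    using span_add[OF span_base span_scale[OF span_base], of a "{a, b}" b r]
    by (intro span_minimal) auto
  have join: "convex hull (span {a + r *\<^sub>R b} \<union> span {a + s *\<^sub>R b}) = span {a, b}" if "r \<noteq> s" for r s
  proof
    show "convex hull (span {a + r *\<^sub>R b} \<union> span {a + s *\<^sub>R b}) \<subseteq> span {a, b}"
      by (intro hull_minimal Un_least sub subspace_imp_convex subspace_span)
    show "span {a, b} \<subseteq> convex hull (span {a + r *\<^sub>R b} \<union> span {a + s *\<^sub>R b})"
    proof
      fix x assume "x \<in> span {a, b}"
      then obtain p q where x: "x = p *\<^sub>R a + q *\<^sub>R b"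
        by (auto simp: plane)
      \<comment> \<open>Here \<open>k\<close> and \<open>l\<close> solve \<open>k + l = p\<close>
        and \<open>k * r + l * s = q\<close>; the determinant is nonzero because
        \<open>r \<noteq> s\<close>.\<close>
      define k where "k = (q - p * s) / (r - s)"
      define l where "l = (p * r - q) / (r - s)"
      have "k + l = p" "k * r + l * s = q"
        using that by (simp_all add: k_def l_def divide_simps) (simp_all add: algebra_simps)
      then have "x = (k + l) *\<^sub>R a + (k * r + l * s) *\<^sub>R b"
        by (simp only: x)
      also have "\<dots> = k *\<^sub>R (a + r *\<^sub>R b) + l *\<^sub>R (a + s *\<^sub>R b)"
        by (simp add: algebra_simps)
      finally show "x \<in> convex hull (span {a + r *\<^sub>R b} \<union> span {a + s *\<^sub>R b})"
        unfolding convex_hull_Un_subspaces[OF subspace_span subspace_span]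
        by (blast intro: span_scale span_base)
    qed
  qed
  have proper: "span {a + r *\<^sub>R b} \<noteq> {0}" "span {a + r *\<^sub>R b} \<noteq> span {a, b}" for r
    using 0[of r] b[of r] by (auto dest: equalityD1 equalityD2 intro: span_base)
  have "b \<noteq> 0"
    using ind[of 0 1] by auto
  then have "{0} \<noteq> span {a, b}"
    by (auto intro: span_base)
  have carrier: "span X \<in> carrier Conv0" for X :: "'a set"
    by (simp add: subspace_imp_convex span_zero)
  show ?thesis
  proof (intro lattice_copy_M_lat[OF lattice_Conv0] carrier proper \<open>{0} \<noteq> span {a, b}\<close>)
    show "{0} \<in> carrier (Conv0 :: 'a set gorder)"
      by simp
    show "span {a + g i *\<^sub>R b} \<sqinter>\<^bsub>Conv0\<^esub> span {a + g j *\<^sub>R b} = {0}"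
      "span {a + g i *\<^sub>R b} \<squnion>\<^bsub>Conv0\<^esub> span {a + g j *\<^sub>R b} = span {a, b}"
      if "i \<in> I" "j \<in> I" "i \<noteq> j" for i j
      using that inj_onD[OF g, of i j] meet[of "g i" "g j"] join[of "g i" "g j"]
      by (auto simp only: Conv0_meet[OF carrier carrier] Conv0_join[OF carrier carrier])
  qed (simp_all add: sub span_zero)
qed

section \<open>The simplex and its sectors\<close>

text \<open>The \<open>n + 1\<close> vectors are the standard basis and minus its sum, the latter indexed by \<open>None\<close>. In
  the same indexing \<open>shift j - shift i\<close> is the direction \<open>d\<close>.\<close>

definition normal :: "'n::finite option \<Rightarrow> real^'n" where
  "normal k = (case k of None \<Rightarrow> - 1 | Some i \<Rightarrow> axis i 1)"

definition shift :: "'n::finite option \<Rightarrow> real^'n" where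
  "shift k = (case k of None \<Rightarrow> 0 | Some i \<Rightarrow> axis i 1)"

text \<open>Each \<open>normal k \<bullet> shift j\<close> is the Kronecker delta of
  \<open>k\<close> and \<open>j\<close> minus that of \<open>k\<close> and \<open>None\<close>; the
  second term cancels in the difference.\<close>

lemma normal_shift:
  fixes i j k :: "'n::finite option"
  shows "normal k \<bullet> (shift j - shift i) = (if k = j then 1 else 0) - (if k = i then 1 else 0)"
proof -
  have "axis a (1::real) $ b = (if b = a then 1 else 0)" for a b :: 'n
    by (simp add: axis_def)
  then show ?thesis
    by (cases k; cases j; cases i) (auto simp: normal_def shift_def inner_diff_right inner_axis)
qed

text \<open>The numbers \<open>normal k \<bullet> x + 1\<close> sum to n + 1 and are proportional to
  the barycentric coordinates of \<open>x\<close>, so the origin is the barycentre.\<close>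

definition centred_simplex :: "(real^'n::finite) set" where
  "centred_simplex = {x. \<forall>k. normal k \<bullet> x > - 1}"

definition sector :: "'n::finite option \<Rightarrow> (real^'n) set" where
  "sector i = {x. \<forall>k. k \<noteq> i \<longrightarrow> normal i \<bullet> x < normal k \<bullet> x}"

text \<open>The margin 1 allows weak inequalities, hence closed sets, that are still disjoint and
  avoid the origin.\<close>

definition closed_sector :: "'n::finite option \<Rightarrow> (real^'n) set" where
  "closed_sector i = {x. \<forall>k. k \<noteq> i \<longrightarrow> normal i \<bullet> x + 1 \<le> normal k \<bullet> x}"

lemma centred_simplex_eq: "centred_simplex = (\<Inter>k. {x. normal k \<bullet> x > - 1})"
  by (auto simp: centred_simplex_def)

lemma sector_eq: "sector i = (\<Inter>k\<in>- {i}. {x. (normal i - normal k) \<bullet> x < 0})"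
  by (auto simp: sector_def inner_diff_left)

lemma closed_sector_eq: "closed_sector i = (\<Inter>k\<in>- {i}. {x. (normal i - normal k) \<bullet> x \<le> - 1})"
  by (auto simp: closed_sector_def inner_diff_left algebra_simps)

lemma convex_centred_simplex: "convex centred_simplex" and open_centred_simplex: "open centred_simplex"
  by (auto simp: centred_simplex_eq intro!: convex_INT convex_halfspace_gt open_INT open_halfspace_gt)

lemma convex_sector: "convex (sector i)" and open_sector: "open (sector i)"
  by (auto simp: sector_eq intro!: convex_INT convex_halfspace_lt open_INT open_halfspace_lt)

lemma convex_closed_sector: "convex (closed_sector i)" and closed_closed_sector: "closed (closed_sector i)"
  by (auto simp: closed_sector_eq intro!: convex_INT convex_halfspace_le closed_INT closed_halfspace_le)

lemma zero_in_centred_simplex: "0 \<in> centred_simplex"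
  by (simp add: centred_simplex_def)

lemma exists_other_option: "\<exists>j::'a option. j \<noteq> i"
  by (cases i) auto

lemma zero_notin_sector: "0 \<notin> sector i" and zero_notin_closed_sector: "0 \<notin> closed_sector i"
  using exists_other_option[of i] by (auto simp: sector_def closed_sector_def)

lemma sector_disjoint: "i \<noteq> j \<Longrightarrow> sector i \<inter> sector j = {}"
  and closed_sector_disjoint: "i \<noteq> j \<Longrightarrow> closed_sector i \<inter> closed_sector j = {}"
  by (force simp: sector_def closed_sector_def)+

text \<open>Every coordinate exceeds -1, so its absolute value is at most the coordinate plus 2; the
  constraint for \<open>None\<close> keeps the sum of the coordinates below 1.\<close>

lemma bounded_centred_simplex: "bounded (centred_simplex :: (real^'n::finite) set)"
proof -
  have "norm x \<le> 1 + 2 * CARD('n)" if "x \<in> centred_simplex" for x :: "real^'n"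
  proof -
    have x: "x $ k > - 1" for k
      using that unfolding centred_simplex_def by (auto dest!: spec[of _ "Some k"] simp: normal_def inner_axis')
    have "- (\<Sum>k\<in>UNIV. x $ k) > - 1"
      using that unfolding centred_simplex_def
      by (auto dest!: spec[of _ None] simp: normal_def inner_vec_def sum_negf)
    have "norm x \<le> (\<Sum>k\<in>UNIV. \<bar>x $ k\<bar>)"
      by (rule norm_le_l1_cart)
    also have "\<dots> \<le> (\<Sum>k\<in>UNIV. x $ k + 2)"
      using x by (intro sum_mono) (smt (verit))
    also have "\<dots> \<le> 1 + 2 * CARD('n)"
      using \<open>- (\<Sum>k\<in>UNIV. x $ k) > - 1\<close> by (simp add: sum.distrib)
    finally show ?thesis .
  qed
  then show ?thesis
    by (auto simp: bounded_iff)
qed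

text \<open>Scaling by \<open>t \<ge> 1\<close> only widens gaps that are already at least 1, so the
  ray from any point of the sector away from the origin stays inside.\<close>

lemma unbounded_closed_sector:
  assumes "closed_sector i \<noteq> {}"
  shows "\<not> bounded (closed_sector i)"
proof
  assume "bounded (closed_sector i)"
  then obtain c where c: "\<And>x. x \<in> closed_sector i \<Longrightarrow> norm x \<le> c"
    by (auto simp: bounded_iff)
  obtain x where x: "x \<in> closed_sector i"
    using assms by blast
  have "x \<noteq> 0"
    using x zero_notin_closed_sector by auto
  define t where "t = max 1 ((c + 1) / norm x)"
  have "t \<ge> 1"
    by (simp add: t_def)
  have "t *\<^sub>R x \<in> closed_sector i"
    unfolding closed_sector_def
  proof clarify
    fix k assume "k \<noteq> i"
    then have "1 \<le> normal k \<bullet> x - normal i \<bullet> x"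
      using x by (auto simp: closed_sector_def algebra_simps)
    then have "1 * 1 \<le> t * (normal k \<bullet> x - normal i \<bullet> x)"
      using \<open>t \<ge> 1\<close> by (intro mult_mono) auto
    then show "normal i \<bullet> (t *\<^sub>R x) + 1 \<le> normal k \<bullet> (t *\<^sub>R x)"
      by (simp add: algebra_simps)
  qed
  then have "t * norm x \<le> c"
    using c \<open>t \<ge> 1\<close> by fastforce
  moreover have "t * norm x \<ge> (c + 1) / norm x * norm x"
    unfolding t_def by (intro mult_right_mono) auto
  ultimately show False
    using \<open>x \<noteq> 0\<close> by simp
qed

section \<open>Hulls of two sectors\<close>

lemma mem_convex_hull_Un_line:
  fixes x d :: "'a::real_vector"
  assumes "x + s *\<^sub>R d \<in> A" "x - t *\<^sub>R d \<in> B" "s > 0" "t > 0"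
  shows "x \<in> convex hull (A \<union> B)"
proof -
  let ?H = "convex hull (A \<union> B)"
  \<comment> \<open>The weights are inverse to the distances travelled, so the multiples of
    \<open>d\<close> cancel.\<close>
  have 1: "t / (s + t) + s / (s + t) = 1"
    using assms by (simp add: add_divide_distrib [symmetric])
  have "(t / (s + t)) *\<^sub>R (x + s *\<^sub>R d) + (s / (s + t)) *\<^sub>R (x - t *\<^sub>R d) \<in> ?H"
    using assms 1 by (intro convexD[OF convex_convex_hull]) (auto simp: hull_inc)
  also have "(t / (s + t)) *\<^sub>R (x + s *\<^sub>R d) + (s / (s + t)) *\<^sub>R (x - t *\<^sub>R d)
      = (t / (s + t) + s / (s + t)) *\<^sub>R x"
    by (simp add: algebra_simps)
  finally show ?thesis
    by (simp add: 1)
qed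

lemma normal_line:
  "normal k \<bullet> (x + t *\<^sub>R (shift j - shift i))
    = normal k \<bullet> x + (if k = j then t else 0) - (if k = i then t else 0)"
  by (simp add: inner_add_right normal_shift)

lemma convex_hull_closed_sectors:
  fixes i j :: "'n::finite option"
  assumes "i \<noteq> j"
  shows "convex hull (closed_sector i \<union> closed_sector j) = UNIV"
proof (intro equalityI subsetI UNIV_I)
  fix x :: "real^'n"
  \<comment> \<open>Averaging the bounds \<open>t\<close> for two indices \<open>l\<close> and
    \<open>m\<close> gives \<open>normal l \<bullet> x - normal m \<bullet> x + 1 \<le> t\<close>.
    Lowering the \<open>l\<close>-th value by \<open>t\<close> thus reaches the closed sector, as no
    other value drops.\<close>
  define t where "t = (\<Sum>k\<in>UNIV. 2 * \<bar>normal k \<bullet> x\<bar>) + 1"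
  have t: "2 * \<bar>normal k \<bullet> x\<bar> + 1 \<le> t" for k
    unfolding t_def by (intro add_right_mono member_le_sum) auto
  have "t > 0"
    using t[of i] by linarith
  have in_sector: "x + t *\<^sub>R (shift k - shift l) \<in> closed_sector l" if "k \<noteq> l" for k l
    unfolding closed_sector_def
  proof clarify
    fix m assume "m \<noteq> l"
    then show "normal l \<bullet> (x + t *\<^sub>R (shift k - shift l)) + 1 \<le> normal m \<bullet> (x + t *\<^sub>R (shift k - shift l))"
      using t[of m] t[of l] \<open>t > 0\<close> that unfolding normal_line by (auto split: if_splits)
  qed
  show "x \<in> convex hull (closed_sector i \<union> closed_sector j)"
    using in_sector[of j i] in_sector[of i j] assms \<open>t > 0\<close>
    by (intro mem_convex_hull_Un_line[of x t "shift j - shift i" _ t]) (auto simp: algebra_simps)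
qed

lemma convex_hull_centred_simplex_sectors:
  fixes i j :: "'n::finite option"
  assumes "i \<noteq> j"
  shows "convex hull ((centred_simplex \<inter> sector i) \<union> (centred_simplex \<inter> sector j)) = centred_simplex"
proof
  show "convex hull ((centred_simplex \<inter> sector i) \<union> (centred_simplex \<inter> sector j)) \<subseteq> centred_simplex"
    by (intro hull_minimal convex_centred_simplex) auto
  show "centred_simplex \<subseteq> convex hull ((centred_simplex \<inter> sector i) \<union> (centred_simplex \<inter> sector j))"
  proof
    fix x :: "real^'n" assume "x \<in> centred_simplex"
    then have x: "normal k \<bullet> x + 1 > 0" for k
      by (auto simp: centred_simplex_def algebra_simps dest: spec[of _ k])
    \<comment> \<open>This \<open>e\<close> is positive and below every
      \<open>normal k \<bullet> x + 1\<close>. Lowering the \<open>l\<close>-th value to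
      \<open>e - 1\<close> makes it the strict minimum while keeping it above -1, so the point stays
      in the simplex.\<close>
    define e where "e = Min (range (\<lambda>k. normal k \<bullet> x + 1)) / 2"
    have e: "0 < e" "e < normal k \<bullet> x + 1" for k
    proof -
      have "Min (range (\<lambda>k. normal k \<bullet> x + 1)) > 0"
        using x by (subst Min_gr_iff) auto
      moreover have "Min (range (\<lambda>k. normal k \<bullet> x + 1)) \<le> normal k \<bullet> x + 1"
        by (intro Min_le) auto
      ultimately show "0 < e" "e < normal k \<bullet> x + 1"
        unfolding e_def by linarith+
    qed
    have in_sector: "x + (normal l \<bullet> x + 1 - e) *\<^sub>R (shift k - shift l) \<in> centred_simplex \<inter> sector l"
      if "k \<noteq> l" for k l
      using e(1) e(2)[of l] e(2) that unfolding centred_simplex_def sector_def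
      by (auto simp: normal_line intro: add_strict_mono) (smt (verit))+
    show "x \<in> convex hull ((centred_simplex \<inter> sector i) \<union> (centred_simplex \<inter> sector j))"
      using in_sector[of j i] in_sector[of i j] assms e(2)[of i] e(2)[of j]
      by (intro mem_convex_hull_Un_line[of x "normal i \<bullet> x + 1 - e" "shift j - shift i" _
            "normal j \<bullet> x + 1 - e"]) (auto simp: algebra_simps)
  qed
qed

section \<open>Adjoining the origin\<close>

lemma convex_insert_zero:
  fixes A :: "'a::real_vector set"
  assumes "convex A" and scale: "\<And>x t. x \<in> A \<Longrightarrow> 0 < t \<Longrightarrow> t \<le> 1 \<Longrightarrow> t *\<^sub>R x \<in> A"
  shows "convex (insert 0 A)"
proof (rule convexI)
  fix x y u v assume *: "x \<in> insert 0 A" "y \<in> insert 0 A" "0 \<le> (u::real)" "0 \<le> v" "u + v = 1"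
  have scale0: "t *\<^sub>R z \<in> insert 0 A" if "z \<in> insert 0 A" "0 \<le> t" "t \<le> 1" for z t
    using that scale[of z t] by (cases "t = 0") auto
  have "u *\<^sub>R x \<in> insert 0 A" "v *\<^sub>R y \<in> insert 0 A"
    using scale0[of x u] scale0[of y v] * by linarith+
  then show "u *\<^sub>R x + v *\<^sub>R y \<in> insert 0 A"
    \<comment> \<open>When one point is the origin, the combination is just the scaled other point,
      which \<open>scale0\<close> has placed in the set.\<close>
    using * convexD[OF assms(1), of x y u v] by (cases "x = 0 \<or> y = 0") auto
qed

text \<open>Shrinking towards the origin preserves the simplex, which is convex and contains 0, and
  the sector, whose inequalities are homogeneous.\<close>

lemma convex_insert_zero_centred_simplex_sector: "convex (insert 0 (centred_simplex \<inter> sector i))"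
proof (intro convex_insert_zero convex_Int convex_centred_simplex convex_sector)
  fix x t assume x: "x \<in> centred_simplex \<inter> sector i" and t: "0 < t" "t \<le> (1::real)"
  have "t *\<^sub>R x + (1 - t) *\<^sub>R 0 \<in> centred_simplex"
    using x t zero_in_centred_simplex by (intro convexD[OF convex_centred_simplex]) auto
  then show "t *\<^sub>R x \<in> centred_simplex \<inter> sector i"
    using x t by (auto simp: sector_def)
qed

lemma least_bottom:
  assumes "lattice_copy K L S" "B \<in> S" "\<And>A. A \<in> S \<Longrightarrow> B \<sqsubseteq>\<^bsub>L\<^esub> A"
  shows "least L B S"
  using assms by (auto simp: least_def lattice_copy_def sublattice_def)


theorem lemma16:
  assumes "CARD('n::finite) > 1"
  shows
    "(\<exists>S. lattice_copy (M_lat {..<CARD('n) + 1}) (Conv :: (real^'n) set gorder) S \<and>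
          least Conv {} S \<and> (\<forall>A\<in>S. open A \<and> bounded A)) \<and>
     (\<exists>S. lattice_copy (M_lat {..<CARD('n) + 1}) (Conv :: (real^'n) set gorder) S \<and>
          least Conv {} S \<and> (\<forall>A\<in>S. A \<noteq> {} \<longrightarrow> closed A \<and> \<not> bounded A)) \<and>
     (\<exists>S. lattice_copy (M_lat {..<CARD('n) + 1}) (Conv0 :: (real^'n) set gorder) S \<and>
          least Conv0 {0} S \<and> (\<forall>A\<in>S. bounded A)) \<and>
     (\<exists>S. lattice_copy (M_lat (UNIV :: real set)) (Conv0 :: (real^'n) set gorder) S \<and>
          least Conv0 {0} S \<and> (\<forall>A\<in>S. subspace A)) \<and>
     (\<forall>m::nat. \<exists>S. lattice_copy (M_lat {..<m}) (Conv0 :: (real^'n) set gorder) S \<and>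
          least Conv0 {0} S \<and> (\<forall>A\<in>S. subspace A)) \<and>
     (\<forall>N\<ge>1.
        \<not> join_semidistributive N (Conv :: (real^'n) set gorder) \<and>
        \<not> meet_semidistributive N (Conv :: (real^'n) set gorder) \<and>
        \<not> join_semidistributive N (Conv0 :: (real^'n) set gorder) \<and>
        \<not> meet_semidistributive N (Conv0 :: (real^'n) set gorder)) \<and>
     (let L = Conv\<lparr>carrier := {A :: (real^'n) set. convex A \<and> open A \<and> bounded A}\<rparr> in
        \<not> join_semidistributive (CARD('n) - 1) L \<and>
        \<not> meet_semidistributive (CARD('n) - 1) L) \<and>
     (let L = Conv0\<lparr>carrier := {A :: (real^'n) set. convex A \<and> 0 \<in> A \<and> bounded A}\<rparr> in
        \<not> join_semidistributive (CARD('n) - 1) L \<and>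
        \<not> meet_semidistributive (CARD('n) - 1) L)"
proof -
  let ?I = "{..<CARD('n) + 1}"
  \<comment> \<open>The option type over \<open>'n\<close> has exactly n + 1 elements, so the
    sectors can be numbered by the index set of \<open>M_lat\<close>.\<close>
  obtain h :: "nat \<Rightarrow> 'n option" where h: "bij_betw h ?I UNIV"
    using ex_bij_betw_nat_finite[of "UNIV :: 'n option set"]
    by (auto simp: card_UNIV_option lessThan_atLeast0)
  have h_inj: "h i \<noteq> h j" if "i \<in> ?I" "j \<in> ?I" "i \<noteq> j" for i j
    using h that by (auto simp: bij_betw_def inj_on_eq_iff)
  have other: "\<exists>j\<in>?I. j \<noteq> i" for i
    using assms by (intro bexI[of _ "if i = 0 then 1 else 0"]) auto

  \<comment> \<open>The open bounded copy\<close>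
  define S1 where "S1 = {{}, centred_simplex} \<union> (\<lambda>i. centred_simplex \<inter> sector (h i)) ` ?I"
  have copy1: "lattice_copy (M_lat ?I) Conv S1"
    unfolding S1_def
  proof (intro lattice_copy_M_lat_pairwise[OF lattice_Conv other])
    fix i j assume ij: "i \<in> ?I" "j \<in> ?I" "i \<noteq> j"
    show "(centred_simplex \<inter> sector (h i)) \<sqinter>\<^bsub>Conv\<^esub> (centred_simplex \<inter> sector (h j)) = {}"
      using sector_disjoint[OF h_inj[OF ij]]
      by (auto simp: Conv_meet convex_Int convex_centred_simplex convex_sector)
    show "(centred_simplex \<inter> sector (h i)) \<squnion>\<^bsub>Conv\<^esub> (centred_simplex \<inter> sector (h j)) = centred_simplex"
      using convex_hull_centred_simplex_sectors[OF h_inj[OF ij]]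
      by (simp add: Conv_join convex_Int convex_centred_simplex convex_sector)
  next
    fix i
    show "centred_simplex \<inter> sector (h i) \<noteq> centred_simplex"
      using zero_in_centred_simplex zero_notin_sector by blast
  qed (simp add: convex_Int convex_centred_simplex convex_sector)
  have S1: "least Conv {} S1" "\<forall>A\<in>S1. open A \<and> bounded A"
    by (rule least_bottom[OF copy1])
      (auto simp: S1_def open_Int open_centred_simplex open_sector bounded_centred_simplex bounded_Int)

  \<comment> \<open>The closed unbounded copy\<close>
  define S2 where "S2 = {{}, UNIV} \<union> (\<lambda>i. closed_sector (h i)) ` ?I"
  have copy2: "lattice_copy (M_lat ?I) Conv S2"
    unfolding S2_def
  proof (intro lattice_copy_M_lat_pairwise[OF lattice_Conv other])
    fix i j assume ij: "i \<in> ?I" "j \<in> ?I" "i \<noteq> j"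
    show "closed_sector (h i) \<sqinter>\<^bsub>Conv\<^esub> closed_sector (h j) = {}"
      "closed_sector (h i) \<squnion>\<^bsub>Conv\<^esub> closed_sector (h j) = UNIV"
      using closed_sector_disjoint[OF h_inj[OF ij]] convex_hull_closed_sectors[OF h_inj[OF ij]]
      by (simp_all add: Conv_meet Conv_join convex_closed_sector)
  next
    fix i
    show "closed_sector (h i) \<noteq> UNIV"
      using zero_notin_closed_sector by blast
  qed (simp add: convex_closed_sector)
  have S2: "least Conv {} S2" "\<forall>A\<in>S2. A \<noteq> {} \<longrightarrow> closed A \<and> \<not> bounded A"
    by (rule least_bottom[OF copy2])
      (auto simp: S2_def closed_closed_sector unbounded_closed_sector not_bounded_UNIV)

  \<comment> \<open>The bounded copy over the origin\<close>
  define F where "F i = insert 0 (centred_simplex \<inter> sector (h i))" for i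
  have F_conv: "F i \<in> carrier Conv0" for i
    by (simp add: F_def convex_insert_zero_centred_simplex_sector)
  have F_sub: "F i \<subseteq> centred_simplex" for i
    by (auto simp: F_def zero_in_centred_simplex)
  define S3 where "S3 = {{0}, centred_simplex} \<union> F ` ?I"
  have F_join: "convex hull (F i \<union> F j) = centred_simplex" if ij: "i \<in> ?I" "j \<in> ?I" "i \<noteq> j" for i j
  proof
    show "convex hull (F i \<union> F j) \<subseteq> centred_simplex"
      by (intro hull_minimal Un_least F_sub convex_centred_simplex)
    have "centred_simplex \<inter> sector (h i) \<union> centred_simplex \<inter> sector (h j) \<subseteq> F i \<union> F j"
      by (auto simp: F_def)
    then show "centred_simplex \<subseteq> convex hull (F i \<union> F j)"
      using convex_hull_centred_simplex_sectors[OF h_inj[OF ij]] hull_mono by metis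
  qed
  have copy3: "lattice_copy (M_lat ?I) Conv0 S3"
    unfolding S3_def
  proof (intro lattice_copy_M_lat_pairwise[OF lattice_Conv0 other F_conv])
    fix i j assume ij: "i \<in> ?I" "j \<in> ?I" "i \<noteq> j"
    show "F i \<sqinter>\<^bsub>Conv0\<^esub> F j = {0}"
      unfolding Conv0_meet[OF F_conv F_conv]
      using sector_disjoint[OF h_inj[OF ij]] by (auto simp: F_def)
    show "F i \<squnion>\<^bsub>Conv0\<^esub> F j = centred_simplex"
      using F_join[OF ij] by (simp only: Conv0_join[OF F_conv F_conv])
  next
    fix i assume "i \<in> ?I"
    obtain j where "j \<in> ?I" "j \<noteq> i"
      using other by blast
    have dj: "sector (h i) \<inter> sector (h j) = {}"
      using \<open>i \<in> ?I\<close> \<open>j \<in> ?I\<close> \<open>j \<noteq> i\<close> by (intro sector_disjoint h_inj) auto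
    \<comment> \<open>The origin lies in both sets and cannot separate them directly. If they were
      equal, the simplex would miss sector \<open>h j\<close>, and the hull identity would make
      \<open>centred_simplex \<inter> sector (h i)\<close> the whole simplex, although it lacks the
      origin.\<close>
    show "F i \<noteq> centred_simplex"
    proof
      assume "F i = centred_simplex"
      moreover have "F i \<inter> sector (h j) = {}"
        using dj zero_notin_sector[of "h j"] by (auto simp: F_def)
      ultimately have "centred_simplex \<inter> sector (h j) = {}"
        by simp
      then have "convex hull (centred_simplex \<inter> sector (h i)) = centred_simplex"
        using convex_hull_centred_simplex_sectors[of "h i" "h j"] h_inj[of i j]
          \<open>i \<in> ?I\<close> \<open>j \<in> ?I\<close> \<open>j \<noteq> i\<close> by auto
      then have "centred_simplex \<inter> sector (h i) = centred_simplex"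
        by (simp add: convex_hull_eq[THEN iffD2] convex_Int convex_centred_simplex convex_sector)
      then show False
        using zero_in_centred_simplex zero_notin_sector by blast
    qed
  qed
  have S3: "least Conv0 {0} S3" "\<forall>A\<in>S3. bounded A"
    by (rule least_bottom[OF copy3])
      (auto simp: S3_def F_def zero_in_centred_simplex bounded_centred_simplex bounded_Int)

  \<comment> \<open>The copies consisting of subspaces\<close>
  obtain p q :: 'n where "p \<noteq> q"
    using assms by (metis UNIV_I card_le_Suc0_iff_eq finite_code linorder_not_le One_nat_def)
  define a where "a = (axis p 1 :: real^'n)"
  define b where "b = (axis q 1 :: real^'n)"
  have ind: "s = 0 \<and> t = 0" if "s *\<^sub>R a + t *\<^sub>R b = 0" for s t
  proof -
    have "(s *\<^sub>R a + t *\<^sub>R b) $ p = 0" "(s *\<^sub>R a + t *\<^sub>R b) $ q = 0"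
      by (simp_all only: that zero_index)
    then show ?thesis
      using \<open>p \<noteq> q\<close> by (simp add: a_def b_def axis_def)
  qed
  \<comment> \<open>The index set stays arbitrary: \<open>real\<close> on \<open>{..<m}\<close>
    yields the finite copies, \<open>id\<close> on all reals the continuum copy.\<close>
  have lines: "lattice_copy (M_lat I) Conv0 ({{0}, span {a, b}} \<union> (\<lambda>i. span {a + g i *\<^sub>R b}) ` I)"
      "least Conv0 {0} ({{0}, span {a, b}} \<union> (\<lambda>i. span {a + g i *\<^sub>R b}) ` I)"
      "\<forall>A\<in>{{0}, span {a, b}} \<union> (\<lambda>i. span {a + g i *\<^sub>R b}) ` I. subspace A"
    if "inj_on g I" for g and I :: "'i set"
  proof -
    show copy: "lattice_copy (M_lat I) Conv0 ({{0}, span {a, b}} \<union> (\<lambda>i. span {a + g i *\<^sub>R b}) ` I)"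
      using ind that by (rule lattice_copy_lines)
    show "least Conv0 {0} ({{0}, span {a, b}} \<union> (\<lambda>i. span {a + g i *\<^sub>R b}) ` I)"
      by (rule least_bottom[OF copy]) (auto simp: span_zero)
  qed (auto simp: subspace_single_0)
  have M_nat: "\<exists>S. lattice_copy (M_lat {..<m}) (Conv0 :: (real^'n) set gorder) S \<and>
      least Conv0 {0} S \<and> (\<forall>A\<in>S. subspace A)" for m :: nat
    using lines[of real "{..<m}"] by (auto simp: inj_on_def)
  have M_real: "\<exists>S. lattice_copy (M_lat (UNIV :: real set)) (Conv0 :: (real^'n) set gorder) S \<and>
      least Conv0 {0} S \<and> (\<forall>A\<in>S. subspace A)"
    using lines[of id UNIV] by auto

  \<comment> \<open>Failure of the semidistributive laws\<close>
  have not_sd: "\<not> join_semidistributive N (Conv :: (real^'n) set gorder) \<and>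
      \<not> meet_semidistributive N (Conv :: (real^'n) set gorder) \<and>
      \<not> join_semidistributive N (Conv0 :: (real^'n) set gorder) \<and>
      \<not> meet_semidistributive N (Conv0 :: (real^'n) set gorder)" if "N \<ge> 1" for N
  proof -
    obtain S where S: "lattice_copy (M_lat {..<N + 2}) (Conv0 :: (real^'n) set gorder) S"
      using M_nat by blast
    then have "S \<subseteq> carrier Conv0"
      by (simp add: lattice_copy_def sublattice_def)
    \<comment> \<open>As \<open>Conv0\<close> is a sublattice of \<open>Conv\<close>, one copy of
      \<open>M_lat {..<N + 2}\<close> refutes the laws in both.\<close>
    moreover have "Conv\<lparr>carrier := carrier Conv0\<rparr> = (Conv0 :: (real^'n) set gorder)"
      by (simp add: Conv0_def)
    ultimately have "lattice_copy (M_lat {..<N + 2}) Conv S"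
      using lattice_copy_sublattice_iff[OF lattice_Conv sublattice_Conv0] S by metis
    then show ?thesis
      using not_semidistributive_if_lattice_copy[OF lattice_Conv _ that]
        not_semidistributive_if_lattice_copy[OF lattice_Conv0 S that] by blast
  qed

  \<comment> \<open>The bounded copies have n + 1 = N + 2 atoms for N = n - 1, and n > 1 makes this
    N positive.\<close>
  have N: "CARD('n) - 1 \<ge> 1" "CARD('n) - 1 + 2 = CARD('n) + 1"
    using assms by auto
  have "S1 \<subseteq> {A. convex A \<and> open A \<and> bounded A}" "S3 \<subseteq> {A. convex A \<and> 0 \<in> A \<and> bounded A}"
    using copy1 S1(2) copy3 S3(2) by (auto simp: lattice_copy_def sublattice_def)
  then have sub_copy:
    "lattice_copy (M_lat ?I) (Conv\<lparr>carrier := {A. convex A \<and> open A \<and> bounded A}\<rparr>) S1"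
    "lattice_copy (M_lat ?I) (Conv0\<lparr>carrier := {A. convex A \<and> 0 \<in> A \<and> bounded A}\<rparr>) S3"
    using copy1 copy3 lattice_copy_sublattice_iff[OF lattice_Conv sublattice_open_bounded]
      lattice_copy_sublattice_iff[OF lattice_Conv0 sublattice_bounded0] by blast+
  note not_sd_bounded =
    not_semidistributive_if_lattice_copy
      [OF sublattice_inherits(1)[OF lattice_Conv sublattice_open_bounded] _ N(1), unfolded N(2), OF sub_copy(1)]
    not_semidistributive_if_lattice_copy
      [OF sublattice_inherits(1)[OF lattice_Conv0 sublattice_bounded0] _ N(1), unfolded N(2), OF sub_copy(2)]
  show ?thesis
    unfolding Let_def
    using copy1 S1 copy2 S2 copy3 S3 M_real M_nat not_sd not_sd_bounded
    by (intro conjI) blast+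
qed

end
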